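(* There exist a weight $w$ on $\mathbb{R}$ and a Haar multiplier $T$ such that $T$ is unbounded as a map from $L^{2}\left(\left(\frac{Mw}{w}\right)^{2}w\right)$ to $L^{2}(w)$; that is, there is no finite constant $C$ such that $$\int_{\mathbb{R}} |Tf(x)|^{2}\, w(x)\,dx \le C \int_{\mathbb{R}} |f(x)|^{2}\left(\frac{Mw(x)}{w(x)}\right)^{2} w(x)\,dx \quad\text{for all } f\in L^2(\mathbb{R}).$$
   Context: A weight is a non-negative locally integrable function on $\mathbb{R}$. $\mathcal{D}=\{[2^{k}m,2^{k}(m+1)) : m,k\in\mathbb{Z}\}$ is the usual dyadic grid. $M$ is the dyadic maximal function: for $f\in L^1_{loc}$, $f\ge 0$, $Mf(x)=\sup_{Q\in\mathcal{D}} \frac{1_Q(x)}{|Q|}\int_Q f$. For $I=[a,b)\in\mathcal{D}$ put $I^-=[a,\frac{a+b}{2})$, $I^+=[\frac{a+b}{2},b)$, and $h_I=\frac{1_{I^+}-1_{I^-}}{|I|^{1/2}}$. Given a bounded sequence $\epsilon=(\epsilon_I)_{I\in\mathcal{D}}$ of scalars, the Haar multiplier $T_\epsilon$ is $T_\epsilon f=\sum_{I\in\mathcal{D}}\epsilon_I\langle f,h_I\rangle h_I$, where $\langle\cdot,\cdot\rangle$ is the pairing with respect to Lebesgue measure (the series converges in $L^2(\mathbb{R})$ for $f\in L^2(\mathbb{R})$). The weight $\left(\frac{Mw}{w}\right)^2 w=\frac{(Mw)^2}{w}$ is understood to be $+\infty$ at points where $w=0$ and $Mw>0$, with the convention $0\cdot\infty=0$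 in the integrand $|f|^2\frac{(Mw)^2}{w}$ (so its dual measure is $\sigma=\frac{w}{(Mw)^2}$). *)

theory Defs
  imports "HOL-Analysis.Analysis"
begin

definition weight :: "(real \<Rightarrow> real) \<Rightarrow> bool" where
  "weight w \<longleftrightarrow> (\<forall>x. 0 \<le> w x) \<and> (\<forall>K. compact K \<longrightarrow> set_integrable lebesgue K w)"

definition dyadic_grid :: "real set set" where
  "dyadic_grid = {{2 powi k * of_int m ..< 2 powi k * (of_int m + 1)} | m k :: int. True}"

text \<open>The dyadic maximal function of a non-negative function; the supremum may be infinite,
  hence the extended range.\<close>

definition dyadic_maximal :: "(real \<Rightarrow> real) \<Rightarrow> real \<Rightarrow> ennreal" where
  "dyadic_maximal f x =
    (SUP Q\<in>dyadic_grid. indicator Q x / emeasure lebesgue Q * (\<integral>\<^sup>+y\<in>Q. ennreal (f y) \<partial>lebesgue))"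

text \<open>A dyadic interval is represented by its underlying set, so its endpoints are recovered
  as infimum and supremum.\<close>

definition left_half :: "real set \<Rightarrow> real set" where
  "left_half I = {Inf I ..< (Inf I + Sup I) / 2}"

definition right_half :: "real set \<Rightarrow> real set" where
  "right_half I = {(Inf I + Sup I) / 2 ..< Sup I}"

definition haar :: "real set \<Rightarrow> real \<Rightarrow> real" where
  "haar I x = (indicator (right_half I) x - indicator (left_half I) x) / sqrt (measure lebesgue I)"

definition square_integrable :: "(real \<Rightarrow> real) \<Rightarrow> bool" where
  "square_integrable f \<longleftrightarrow>
    f \<in> borel_measurable lebesgue \<and> integrable lebesgue (\<lambda>x. (f x)\<^sup>2)"

definition pairing :: "(real \<Rightarrow> real) \<Rightarrow> (real \<Rightarrow> real) \<Rightarrow> real" where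
  "pairing f g = (\<integral>x. f x * g x \<partial>lebesgue)"

text \<open>The Haar multiplier with symbol \<open>\<epsilon>\<close>: a representative of the sum, unconditionally in
  \<open>L\<^sup>2\<close>, of its defining series, which determines it up to null sets. It is meaningful for square
  integrable \<open>f\<close> and \<open>\<epsilon>\<close> bounded on \<open>dyadic_grid\<close>.\<close>

definition haar_multiplier :: "(real set \<Rightarrow> real) \<Rightarrow> (real \<Rightarrow> real) \<Rightarrow> real \<Rightarrow> real" where
  "haar_multiplier \<epsilon> f = (SOME g. square_integrable g \<and>
     ((\<lambda>F. \<integral>x. ((\<Sum>I\<in>F. \<epsilon> I * pairing f (haar I) * haar I x) - g x)\<^sup>2 \<partial>lebesgue) \<longlongrightarrow> 0)
       (finite_subsets_at_top dyadic_grid))"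

text \<open>The weight \<open>(Mw / w)\<^sup>2 w\<close>, written as \<open>(Mw)\<^sup>2 / w\<close>. Division in \<open>ennreal\<close> gives \<open>\<infinity>\<close> where
  \<open>w = 0 < Mw\<close> and \<open>0\<close> where \<open>w = Mw = 0\<close>, and \<open>0 * \<infinity> = 0\<close>.\<close>

definition maximal_weight :: "(real \<Rightarrow> real) \<Rightarrow> real \<Rightarrow> ennreal" where
  "maximal_weight w x = (dyadic_maximal w x)\<^sup>2 / ennreal (w x)"

end

theory Submission
  imports Defs
begin

text \<open>
  Since Haar multipliers are self-adjoint, testing the inequality on \<open>f = 1\<^sub>E\<close> leads to
  \<open>\<integral> T(1\<^sub>E) w = \<integral>\<^sub>E T w\<close>. It therefore suffices to find, for every \<open>L\<close>, a weight \<open>w\<close> of mass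
  \<open>1\<close> on a unit interval and a set \<open>E\<close> carrying at least half of that mass, such that on \<open>E\<close> the
  maximal function of \<open>w\<close> is at most \<open>w\<close> while \<open>T w \<ge> (L/2) w\<close>. Indeed the right-hand side of the
  inequality is then at most \<open>C \<integral>\<^sub>E w \<le> C\<close>, whereas the left-hand side is at least \<open>(L/4)\<^sup>2\<close>.

  The averages of \<open>w\<close> over the dyadic intervals shrinking to a point form a martingale, and \<open>T w\<close>
  may add up selected increments of it. For \<open>T w\<close> to exceed the maximal function by the factor
  \<open>L/2\<close>, the averages must fall and rise again \<open>L\<close> times without passing their final value. On a
  dyadic interval of average \<open>B\<close> this is attempted as follows. The left half gets average \<open>B/2\<close>,
  and all the mass of this half is put into its own right half, which has average \<open>B\<close> again; only
  this rise, of size \<open>B/2\<close>, is counted by \<open>T\<close>. The right half gets average \<open>3B/2\<close>, which is a new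
  record, so there the attempt has failed and a new one starts from the larger value. An attempt
  succeeds only on the tiny proportion \<open>4\<^sup>-\<^sup>L\<close> of its mass. But attempts can be repeated at larger
  and larger averages, earlier gains are never lost on the mass that survives, and after
  sufficiently many steps most of the mass lies in successful attempts
  (\<open>stopped_mass_tendsto\<close>). The set \<open>E\<close> is the union of the successful intervals. That no ancestor
  had a larger average is \<open>tower_average_le\<close>; the gain is \<open>sum_rises\<close> together with
  \<open>rise_energy_ge\<close>.

  Finally one such tower, with parameter \<open>L\<close>, is placed on each unit interval \<open>[L, L+1)\<close>. All unit
  intervals have average \<open>1\<close>, so larger dyadic intervals do not increase the maximal function on
  any \<open>E\<close>. As \<open>T(1\<^sub>E)\<close> is a finite Haar sum for each test set, convergence of the Haar series is
  never an issue (\<open>haar_multiplier_finite\<close>).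
\<close>

section \<open>Dyadic intervals\<close>

definition dyadic :: "int \<Rightarrow> int \<Rightarrow> real set" where
  "dyadic k m = {2 powi k * of_int m ..< 2 powi k * (of_int m + 1)}"

lemma powi_pred: "(2::real) powi (k - 1) = 2 powi k / 2" "(2::real) powi (k - 2) = 2 powi k / 4"
  by (simp_all add: power_int_diff)

lemma dyadic_grid_eq: "dyadic_grid = {dyadic k m | k m. True}"
  unfolding dyadic_grid_def dyadic_def by auto

lemma dyadic_in_grid: "dyadic k m \<in> dyadic_grid"
  by (auto simp: dyadic_grid_eq)

lemma dyadic_lebesgue [measurable]: "dyadic k m \<in> sets lebesgue"
  by (simp add: dyadic_def)

lemma dyadic_nonempty: "dyadic k m \<noteq> {}"
  by (simp add: dyadic_def mult_less_cancel_left_pos)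

lemma emeasure_dyadic: "emeasure lebesgue (dyadic k m) = ennreal (2 powi k)"
  by (simp add: dyadic_def algebra_simps)

lemma measure_dyadic: "measure lebesgue (dyadic k m) = 2 powi k"
  by (simp add: measure_def emeasure_dyadic)

lemma dyadic_halves:
  "left_half (dyadic k m) = dyadic (k - 1) (2 * m)"
  "right_half (dyadic k m) = dyadic (k - 1) (2 * m + 1)"
proof -
  have lt: "2 powi k * of_int m < 2 powi k * (of_int m + 1 :: real)"
    by (simp add: mult_less_cancel_left_pos)
  show "left_half (dyadic k m) = dyadic (k - 1) (2 * m)"
    "right_half (dyadic k m) = dyadic (k - 1) (2 * m + 1)"
    using lt unfolding left_half_def right_half_def dyadic_def powi_pred
    by (simp_all add: algebra_simps add_divide_distrib)
qed

lemma dyadic_split: "dyadic k m = dyadic (k - 1) (2 * m) \<union> dyadic (k - 1) (2 * m + 1)"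
proof -
  have "2 powi k * of_int m \<le> (2 powi k * (of_int m + 1/2) :: real)"
       "2 powi k * (of_int m + 1/2) \<le> (2 powi k * (of_int m + 1) :: real)"
    by (simp_all add: mult_left_mono)
  then show ?thesis
    unfolding dyadic_def powi_pred by (auto simp: field_simps)
qed

lemma mem_dyadic_iff: "x \<in> dyadic k m \<longleftrightarrow> \<lfloor>x / 2 powi k\<rfloor> = m"
  by (auto simp: dyadic_def floor_eq_iff field_simps)

lemma dyadic_unique: "x \<in> dyadic k m \<Longrightarrow> x \<in> dyadic k m' \<Longrightarrow> m = m'"
  by (simp add: mem_dyadic_iff)

lemma dyadic_subset_parent: "dyadic k m \<subseteq> dyadic (k + 1) (m div 2)"
proof (cases "even m")
  case True
  then show ?thesis using dyadic_split[of "k+1" "m div 2"] by auto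
next
  case False
  then show ?thesis using dyadic_split[of "k+1" "m div 2"] by auto
qed

lemma dyadic_nested:
  assumes "x \<in> dyadic k m" "x \<in> dyadic k' m'" "k \<le> k'"
  shows "dyadic k m \<subseteq> dyadic k' m'"
proof -
  have "\<exists>l. dyadic k m \<subseteq> dyadic k' l"
    using assms(3)
  proof (induction k' rule: int_ge_induct)
    case base then show ?case by auto
  next
    case (step i) then show ?case using dyadic_subset_parent by (meson order_trans)
  qed
  then show ?thesis using assms dyadic_unique by blast
qed

lemma dyadic_children:
  "dyadic (k - 1) (2 * m + 1) \<subseteq> dyadic k m"
  "dyadic (k - 2) (4 * m + 1) \<subseteq> dyadic (k - 1) (2 * m)"
  "dyadic (k - 1) (2 * m) \<subseteq> dyadic k m"
  "dyadic (k - 1) (2 * m + 1) \<inter> dyadic (k - 1) (2 * m) = {}"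
  using dyadic_split[of k m] dyadic_split[of "k - 1" "2 * m"]
    dyadic_unique[of _ "k - 1" "2 * m" "2 * m + 1"] by fastforce+

section \<open>The tower weight\<close>

text \<open>The parameters are the number \<open>L\<close> of rises in a successful attempt, a bound \<open>n\<close> on the
  remaining recursion depth, the number \<open>j\<close> of rises still missing in the current attempt, the
  average \<open>B\<close>, and the dyadic interval. The interval \<open>dyadic (k - 2) (4 * m + 1)\<close> is the right half of
  the left half.\<close>

fun tower :: "nat \<Rightarrow> nat \<Rightarrow> nat \<Rightarrow> real \<Rightarrow> int \<Rightarrow> int \<Rightarrow> real \<Rightarrow> real" where
  "tower L n 0 B k m x = B * indicator (dyadic k m) x"
| "tower L 0 (Suc j) B k m x = B * indicator (dyadic k m) x"
| "tower L (Suc n) (Suc j) B k m x =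
     tower L n L (3/2 * B) (k - 1) (2 * m + 1) x + tower L n j B (k - 2) (4 * m + 1) x"

text \<open>The intervals that exhaust \<open>n\<close> with an attempt still in progress are left out.\<close>

fun stopped :: "nat \<Rightarrow> nat \<Rightarrow> nat \<Rightarrow> int \<Rightarrow> int \<Rightarrow> real set" where
  "stopped L n 0 k m = dyadic k m"
| "stopped L 0 (Suc j) k m = {}"
| "stopped L (Suc n) (Suc j) k m =
     stopped L n L (k - 1) (2 * m + 1) \<union> stopped L n j (k - 2) (4 * m + 1)"

text \<open>The left halves, inside which the average rises from \<open>B/2\<close> back to \<open>B\<close>; these are the intervals
  selected by the multiplier.\<close>

fun rises :: "nat \<Rightarrow> nat \<Rightarrow> nat \<Rightarrow> int \<Rightarrow> int \<Rightarrow> real set set" where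
  "rises L n 0 k m = {}"
| "rises L 0 (Suc j) k m = {}"
| "rises L (Suc n) (Suc j) k m = insert (dyadic (k - 1) (2 * m))
     (rises L n L (k - 1) (2 * m + 1) \<union> rises L n j (k - 2) (4 * m + 1))"

section \<open>Numerical recursions for the tower\<close>

text \<open>The following quantities are normalised to an interval of length \<open>1\<close> and average \<open>1\<close>. The
  first is the Lebesgue measure of the stopped set, the second its measure with respect to the
  tower weight. They differ because the right half has half of the length but three quarters of
  the mass.\<close>

fun stopped_fraction :: "nat \<Rightarrow> nat \<Rightarrow> nat \<Rightarrow> real" where
  "stopped_fraction L n 0 = 1"
| "stopped_fraction L 0 (Suc j) = 0"
| "stopped_fraction L (Suc n) (Suc j) = stopped_fraction L n L / 2 + stopped_fraction L n j / 4"

fun stopped_mass :: "nat \<Rightarrow> nat \<Rightarrow> nat \<Rightarrow> real" where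
  "stopped_mass L n 0 = 1"
| "stopped_mass L 0 (Suc j) = 0"
| "stopped_mass L (Suc n) (Suc j) = 3/4 * stopped_mass L n L + 1/4 * stopped_mass L n j"

text \<open>The sum of \<open>\<langle>1\<^sub>E, h\<^sub>J\<rangle> \<langle>w, h\<^sub>J\<rangle>\<close> over the selected intervals \<open>J\<close>. The last summand comes from
  the left half \<open>J\<close> of the unit interval itself: there \<open>1\<^sub>E\<close> and \<open>w\<close> live on the right half of \<open>J\<close>, so
  the product is \<open>|J|\<^sup>-\<^sup>1 w(J) |E \<inter> J|\<close> with \<open>|J| = 1/2\<close>, \<open>w(J) = 1/4\<close>.\<close>

fun rise_energy :: "nat \<Rightarrow> nat \<Rightarrow> nat \<Rightarrow> real" where
  "rise_energy L n 0 = 0"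
| "rise_energy L 0 (Suc j) = 0"
| "rise_energy L (Suc n) (Suc j) =
     3/4 * rise_energy L n L + rise_energy L n j / 4 + stopped_fraction L n j / 8"

lemma stopped_mass_bounds: "0 \<le> stopped_mass L n j \<and> stopped_mass L n j \<le> 1"
proof (induction n arbitrary: j)
  case 0 then show ?case by (cases j) auto
next
  case (Suc n)
  show ?case using Suc[of L] Suc[of "j - 1"] by (cases j) auto
qed

lemma stopped_mass_mono: "stopped_mass L n j \<le> stopped_mass L (Suc n) j"
proof (induction n arbitrary: j)
  case 0 then show ?case using stopped_mass_bounds by (cases j) auto
next
  case (Suc n)
  show ?case
  proof (cases j)
    case (Suc i)
    show ?thesis using Suc.IH[of L] Suc.IH[of i] unfolding Suc stopped_mass.simps(3)
      by linarith
  qed simp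
qed

text \<open>The limits \<open>l j\<close> exist by monotonicity. Their recursion makes \<open>l j - l L\<close> shrink by the factor
  \<open>4\<close> when \<open>j\<close> grows by one; as this difference vanishes at \<open>j = L\<close>, it vanishes at \<open>j = 0\<close> too,
  where \<open>l 0 = 1\<close>. All mass is stopped in the limit.\<close>

lemma stopped_mass_tendsto: "(\<lambda>n. stopped_mass L n L) \<longlonglongrightarrow> 1"
proof -
  have "\<exists>l. (\<lambda>n. stopped_mass L n j) \<longlonglongrightarrow> l" for j
  proof -
    have "incseq (\<lambda>n. stopped_mass L n j)" by (rule incseq_SucI) (rule stopped_mass_mono)
    then show ?thesis by (metis incseq_convergent stopped_mass_bounds)
  qed
  then obtain l where l: "\<And>j. (\<lambda>n. stopped_mass L n j) \<longlonglongrightarrow> l j" by metis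
  have l0: "l 0 = 1" using l[of 0] by (simp add: LIMSEQ_const_iff)
  have step: "l (Suc j) = 3/4 * l L + 1/4 * l j" for j
  proof (rule LIMSEQ_unique)
    show "(\<lambda>n. stopped_mass L (Suc n) (Suc j)) \<longlonglongrightarrow> l (Suc j)"
      using l by (rule LIMSEQ_Suc)
    show "(\<lambda>n. stopped_mass L (Suc n) (Suc j)) \<longlonglongrightarrow> 3/4 * l L + 1/4 * l j"
      unfolding stopped_mass.simps by (intro tendsto_intros l)
  qed
  have "l j - l L = (1 - l L) / 4 ^ j" for j
    by (induction j) (simp_all add: l0 step field_simps)
  from this[of L] have "l L = 1" by simp
  then show ?thesis using l by metis
qed

text \<open>This expresses that \<open>T w \<ge> (L/2) w\<close> on the stopped set: a stopped interval of average \<open>B\<close> has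
  seen \<open>L\<close> rises of size \<open>B/2\<close> during its last attempt. Of these, \<open>L - j\<close> took place before the
  recursion entered the present interval; they are accounted for by the second summand on the right.
  Gains of failed attempts are positive and are dropped.\<close>

lemma rise_energy_ge:
  assumes "j \<le> L"
  shows "real L / 2 * stopped_mass L n j
    \<le> rise_energy L n j + (real L - real j) / 2 * stopped_fraction L n j"
  using assms
proof (induction n arbitrary: j)
  case 0 then show ?case by (cases j) auto
next
  case (Suc n)
  show ?case
  proof (cases j)
    case (Suc i)
    have "real L / 2 * stopped_mass L n L \<le> rise_energy L n L"
      using Suc.IH[of L] by simp
    moreover have "real L / 2 * stopped_mass L n i
      \<le> rise_energy L n i + (real L - real i) / 2 * stopped_fraction L n i"
      using Suc.IH[of i] Suc.prems Suc by simp
    moreover have "0 \<le> (real L - real j) * stopped_fraction L n L"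
    proof -
      have "0 \<le> stopped_fraction L n i" for n i
      proof (induction n arbitrary: i)
        case 0 then show ?case by (cases i) auto
      next
        case (Suc n) then show ?case by (cases i) auto
      qed
      then show ?thesis using Suc.prems by simp
    qed
    ultimately show ?thesis unfolding Suc by (simp add: field_simps)
  qed simp
qed


section \<open>Support, mass and averages of the tower\<close>

lemma tower_nonneg: "0 \<le> B \<Longrightarrow> 0 \<le> tower L n j B k m x"
  by (induction L n j B k m x rule: tower.induct) auto

lemma tower_outside: "x \<notin> dyadic k m \<Longrightarrow> tower L n j B k m x = 0"
proof (induction L n j B k m x rule: tower.induct)
  case (3 L n j B k m x)
  then have "x \<notin> dyadic (k - 1) (2 * m + 1)" "x \<notin> dyadic (k - 2) (4 * m + 1)"
    using dyadic_children[of k m] by blast+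
  with 3 show ?case by simp
qed simp_all

lemma stopped_subset: "stopped L n j k m \<subseteq> dyadic k m"
proof (induction L n j k m rule: stopped.induct)
  case (3 L n j k m)
  then show ?case unfolding stopped.simps using dyadic_children[of k m] by blast
qed simp_all

lemma stopped_lebesgue [measurable]: "stopped L n j k m \<in> sets lebesgue"
  by (induction L n j k m rule: stopped.induct) auto

lemma tower_on_children:
  "x \<in> dyadic (k - 1) (2 * m + 1) \<Longrightarrow>
    tower L (Suc n) (Suc j) B k m x = tower L n L (3/2 * B) (k - 1) (2 * m + 1) x"
  "x \<in> dyadic (k - 1) (2 * m) \<Longrightarrow>
    tower L (Suc n) (Suc j) B k m x = tower L n j B (k - 2) (4 * m + 1) x"
proof -
  assume "x \<in> dyadic (k - 1) (2 * m + 1)"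
  then have "x \<notin> dyadic (k - 2) (4 * m + 1)" using dyadic_children[of k m] by blast
  then show "tower L (Suc n) (Suc j) B k m x = tower L n L (3/2 * B) (k - 1) (2 * m + 1) x"
    by (simp add: tower_outside)
next
  assume "x \<in> dyadic (k - 1) (2 * m)"
  then have "x \<notin> dyadic (k - 1) (2 * m + 1)" using dyadic_children[of k m] by blast
  then show "tower L (Suc n) (Suc j) B k m x = tower L n j B (k - 2) (4 * m + 1) x"
    by (simp add: tower_outside)
qed

lemma stopped_on_children:
  "x \<in> dyadic (k - 1) (2 * m + 1) \<Longrightarrow>
    x \<in> stopped L (Suc n) (Suc j) k m \<longleftrightarrow> x \<in> stopped L n L (k - 1) (2 * m + 1)"
  "x \<in> dyadic (k - 1) (2 * m) \<Longrightarrow>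
    x \<in> stopped L (Suc n) (Suc j) k m \<longleftrightarrow> x \<in> stopped L n j (k - 2) (4 * m + 1)"
proof -
  have R: "stopped L n L (k - 1) (2 * m + 1) \<inter> dyadic (k - 1) (2 * m) = {}"
    using stopped_subset[of L n L "k - 1" "2 * m + 1"] dyadic_children(4)[of k m] by blast
  have M: "stopped L n j (k - 2) (4 * m + 1) \<inter> dyadic (k - 1) (2 * m + 1) = {}"
    using stopped_subset[of L n j "k - 2" "4 * m + 1"] dyadic_children(2,4)[of k m] by blast
  show "x \<in> dyadic (k - 1) (2 * m + 1) \<Longrightarrow>
    x \<in> stopped L (Suc n) (Suc j) k m \<longleftrightarrow> x \<in> stopped L n L (k - 1) (2 * m + 1)"
    using M by auto
  show "x \<in> dyadic (k - 1) (2 * m) \<Longrightarrow>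
    x \<in> stopped L (Suc n) (Suc j) k m \<longleftrightarrow> x \<in> stopped L n j (k - 2) (4 * m + 1)"
    using R by auto
qed

lemma tower_ge_on_stopped:
  "0 \<le> B \<Longrightarrow> x \<in> stopped L n j k m \<Longrightarrow> B \<le> tower L n j B k m x"
proof (induction L n j B k m x rule: tower.induct)
  case (3 L n j B k m x)
  show ?case
    using 3 tower_nonneg[of "3/2 * B" L n L "k - 1" "2 * m + 1" x]
      tower_nonneg[of "B" L n j "k - 2" "4 * m + 1" x] by auto
qed auto

lemma has_integral_tower:
  "has_bochner_integral lebesgue (tower L n j B k m) (B * 2 powi k)"
proof -
  have const: "has_bochner_integral lebesgue (\<lambda>x. B * indicator (dyadic k m) x) (B * 2 powi k)"
    for B :: real and k m
    using has_bochner_integral_real_indicator[of "dyadic k m" lebesgue]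
    by (intro has_bochner_integral_mult_right) (simp add: emeasure_dyadic measure_dyadic)
  show ?thesis
  proof (induction n arbitrary: j B k m)
    case 0
    show ?case using const by (cases j) (simp_all add: fun_eq_iff)
  next
    case (Suc n)
    show ?case
    proof (cases j)
      case 0 then show ?thesis using const by simp
    next
      case (Suc i)
      have "3/2 * B * 2 powi (k - 1) + B * 2 powi (k - 2) = B * 2 powi k"
        by (simp add: powi_pred)
      with has_bochner_integral_add[OF Suc.IH Suc.IH,
          of L "3/2 * B" "k - 1" "2 * m + 1" i B "k - 2" "4 * m + 1"]
      show ?thesis unfolding Suc by simp
    qed
  qed
qed

lemma tower_measurable [measurable]: "tower L n j B k m \<in> borel_measurable lebesgue"
  using has_integral_tower has_bochner_integral_iff borel_measurable_integrable by blast

lemma nn_integral_tower: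
  assumes "0 \<le> B"
  shows "(\<integral>\<^sup>+x. ennreal (tower L n j B k m x) \<partial>lebesgue) = ennreal (B * 2 powi k)"
  using has_integral_tower[of L n j B k m] tower_nonneg[OF assms]
  by (simp add: has_bochner_integral_iff nn_integral_eq_integral)

lemma measure_stopped:
  "stopped L n j k m \<in> lmeasurable \<and>
   measure lebesgue (stopped L n j k m) = 2 powi k * stopped_fraction L n j"
proof (induction L n j k m rule: stopped.induct)
  case (1 L n k m)
  then show ?case by (simp add: measure_dyadic fmeasurable_def emeasure_dyadic)
next
  case (3 L n j k m)
  have "stopped L n L (k - 1) (2 * m + 1) \<inter> stopped L n j (k - 2) (4 * m + 1) = {}"
    using stopped_subset[of L n L "k - 1" "2 * m + 1"] dyadic_children[of k m]
      stopped_subset[of L n j "k - 2" "4 * m + 1"] by blast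
  then have "measure lebesgue (stopped L n L (k - 1) (2 * m + 1) \<union> stopped L n j (k - 2) (4 * m + 1))
    = measure lebesgue (stopped L n L (k - 1) (2 * m + 1))
      + measure lebesgue (stopped L n j (k - 2) (4 * m + 1))"
    using 3 by (intro measure_Union) (auto simp: fmeasurable_def)
  then show ?case using 3 by (auto simp: powi_pred field_simps)
qed simp

text \<open>Every dyadic ancestor of a stopped point, up to the whole interval, has average at most the
  value of the weight there. In each step of the construction the average at the top is \<open>B\<close>, on
  the left half it is \<open>B/2\<close>, and the values on the stopped set are at least \<open>B\<close>; inside the right
  half and inside the right half of the left half the induction hypothesis applies.\<close>

lemma tower_average_le:
  assumes "x \<in> stopped L n j k m" "x \<in> dyadic k' m'" "k' \<le> k" "0 < B"
  shows "(\<integral>\<^sup>+y\<in>dyadic k' m'. ennreal (tower L n j B k m y) \<partial>lebesgue)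
    \<le> ennreal (tower L n j B k m x * 2 powi k')"
  using assms
proof (induction n arbitrary: j B k m)
  have const: "(\<integral>\<^sup>+y\<in>dyadic k' m'. ennreal (B * indicator (dyadic k m) y) \<partial>lebesgue)
      \<le> ennreal (B * indicator (dyadic k m) x * 2 powi k')"
    if "x \<in> dyadic k m" "0 < B" for k m B
  proof -
    have "(\<integral>\<^sup>+y\<in>dyadic k' m'. ennreal (B * indicator (dyadic k m) y) \<partial>lebesgue)
        \<le> (\<integral>\<^sup>+y. ennreal B * indicator (dyadic k' m') y \<partial>lebesgue)"
      by (intro nn_integral_mono) (auto simp: indicator_def)
    also have "\<dots> = ennreal B * ennreal (2 powi k')"
      by (subst nn_integral_cmult_indicator) (simp_all add: emeasure_dyadic)
    finally show ?thesis using that by (simp add: ennreal_mult)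
  qed
  {
    case 0 then show ?case using const by (cases j) auto
  next
    case (Suc n)
    let ?W = "tower L (Suc n) j B k m"
    show ?case
    proof (cases j)
      case 0
      then show ?thesis using const Suc.prems by auto
    next
      case (Suc i)
      note j = this
      have Wx: "B \<le> ?W x" using tower_ge_on_stopped Suc.prems by simp
      consider (top) "k' = k" | (right) "k' < k" "x \<in> stopped L n L (k - 1) (2 * m + 1)"
        | (mid) "k' = k - 1" "x \<in> stopped L n i (k - 2) (4 * m + 1)"
        | (low) "k' \<le> k - 2" "x \<in> stopped L n i (k - 2) (4 * m + 1)"
        using Suc.prems(1,3) unfolding j by fastforce
      then show ?thesis
      proof cases
        case top
        have "(\<integral>\<^sup>+y\<in>dyadic k' m'. ennreal (?W y) \<partial>lebesgue) \<le> (\<integral>\<^sup>+y. ennreal (?W y) \<partial>lebesgue)"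
          by (intro nn_integral_mono) (auto simp: indicator_def)
        also have "\<dots> \<le> ennreal (?W x * 2 powi k')"
          unfolding top using Wx Suc.prems
          by (subst nn_integral_tower) (auto intro!: ennreal_leI mult_right_mono)
        finally show ?thesis .
      next
        case right
        let ?V = "tower L n L (3/2 * B) (k - 1) (2 * m + 1)"
        have x: "x \<in> dyadic (k - 1) (2 * m + 1)" using right stopped_subset by blast
        then have "dyadic k' m' \<subseteq> dyadic (k - 1) (2 * m + 1)"
          using dyadic_nested Suc.prems(2) right(1) by (metis zle_diff1_eq)
        then have eq: "?W y = ?V y" if "y \<in> dyadic k' m'" for y
          using tower_on_children(1) that unfolding j by blast
        have "(\<integral>\<^sup>+y\<in>dyadic k' m'. ennreal (?W y) \<partial>lebesgue)
            = (\<integral>\<^sup>+y\<in>dyadic k' m'. ennreal (?V y) \<partial>lebesgue)"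
          using eq by (intro nn_integral_cong) (auto simp: indicator_def)
        also have "\<dots> \<le> ennreal (?V x * 2 powi k')"
          using right Suc.prems by (intro Suc.IH) auto
        finally show ?thesis using eq Suc.prems(2) by simp
      next
        case low
        let ?V = "tower L n i B (k - 2) (4 * m + 1)"
        have x: "x \<in> dyadic (k - 2) (4 * m + 1)" using low stopped_subset by blast
        then have "dyadic k' m' \<subseteq> dyadic (k - 2) (4 * m + 1)"
          using dyadic_nested Suc.prems(2) low(1) by metis
        then have eq: "?W y = ?V y" if "y \<in> dyadic k' m'" for y
          using tower_on_children(2) dyadic_children(2) that unfolding j by blast
        have "(\<integral>\<^sup>+y\<in>dyadic k' m'. ennreal (?W y) \<partial>lebesgue)
            = (\<integral>\<^sup>+y\<in>dyadic k' m'. ennreal (?V y) \<partial>lebesgue)"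
          using eq by (intro nn_integral_cong) (auto simp: indicator_def)
        also have "\<dots> \<le> ennreal (?V x * 2 powi k')"
          using low Suc.prems by (intro Suc.IH) auto
        finally show ?thesis using eq Suc.prems(2) by simp
      next
        case mid
        let ?V = "tower L n i B (k - 2) (4 * m + 1)"
        have "x \<in> dyadic (k - 1) (2 * m)" using mid stopped_subset dyadic_children(2) by blast
        then have "m' = 2 * m" using Suc.prems(2) mid dyadic_unique by blast
        then have eq: "?W y = ?V y" if "y \<in> dyadic k' m'" for y
          using tower_on_children(2) that mid unfolding j by blast
        have "(\<integral>\<^sup>+y\<in>dyadic k' m'. ennreal (?W y) \<partial>lebesgue) \<le> (\<integral>\<^sup>+y. ennreal (?V y) \<partial>lebesgue)"
          using eq by (intro nn_integral_mono) (auto simp: indicator_def)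
        also have "\<dots> = ennreal (B * 2 powi (k - 2))"
          using Suc.prems by (subst nn_integral_tower) auto
        also have "\<dots> \<le> ennreal (?W x * 2 powi k')"
        proof (intro ennreal_leI mult_mono)
          show "(2::real) powi (k - 2) \<le> 2 powi k'" unfolding mid(1) powi_pred by simp
        qed (use Wx Suc.prems in auto)
        finally show ?thesis .
      qed
    qed
  }
qed

section \<open>The Haar pairings of the tower with its stopped set\<close>

lemma finite_rises: "finite (rises L n j k m)"
  by (induction L n j k m rule: rises.induct) auto

lemma rises_dyadic: "J \<in> rises L n j k m \<Longrightarrow> \<exists>k' m'. J = dyadic k' m'"
  by (induction L n j k m rule: rises.induct) auto

lemma rises_subset: "J \<in> rises L n j k m \<Longrightarrow> J \<subseteq> dyadic k m"
proof (induction L n j k m rule: rises.induct)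
  case (3 L n j k m)
  then show ?case unfolding rises.simps using dyadic_children[of k m] by blast
qed simp_all

lemma haar_outside: "x \<notin> dyadic k m \<Longrightarrow> haar (dyadic k m) x = 0"
  using dyadic_split[of k m] unfolding haar_def dyadic_halves by simp

lemma pairing_haar_cong:
  assumes "\<And>x. x \<in> dyadic k m \<Longrightarrow> f x = g x"
  shows "pairing f (haar (dyadic k m)) = pairing g (haar (dyadic k m))"
proof -
  have "(\<lambda>x. f x * haar (dyadic k m) x) = (\<lambda>x. g x * haar (dyadic k m) x)"
  proof
    fix x show "f x * haar (dyadic k m) x = g x * haar (dyadic k m) x"
      using assms haar_outside by (cases "x \<in> dyadic k m") auto
  qed
  then show ?thesis unfolding pairing_def by (rule arg_cong)
qed


lemma pairing_haar_right_half:
  assumes "\<And>x. x \<notin> dyadic (k - 1) (2 * m + 1) \<Longrightarrow> g x = 0"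
  shows "pairing g (haar (dyadic k m)) = (\<integral>x. g x \<partial>lebesgue) / sqrt (2 powi k)"
proof -
  have "g x * haar (dyadic k m) x = g x / sqrt (2 powi k)" for x
  proof (cases "x \<in> dyadic (k - 1) (2 * m + 1)")
    case True
    moreover have "x \<notin> dyadic (k - 1) (2 * m)" using True dyadic_children(4) by blast
    ultimately show ?thesis by (simp add: haar_def dyadic_halves measure_dyadic)
  qed (simp add: assms)
  then show ?thesis unfolding pairing_def by simp
qed

text \<open>The functions are prescribed only on the given interval, because the Haar functions
  concerned see nothing else; this lets the statement pass to subintervals.\<close>

lemma sum_rises:
  assumes "\<And>x. x \<in> dyadic k m \<Longrightarrow> f x = indicator (stopped L n j k m) x"
    and "\<And>x. x \<in> dyadic k m \<Longrightarrow> w x = tower L n j B k m x"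
  shows "(\<Sum>J\<in>rises L n j k m. pairing f (haar J) * pairing w (haar J))
    = B * 2 powi k * rise_energy L n j"
  using assms
proof (induction n arbitrary: j B k m)
  case 0 then show ?case by (cases j) auto
next
  case (Suc n)
  show ?case
  proof (cases j)
    case 0 then show ?thesis by simp
  next
    case (Suc i)
    let ?S = "\<lambda>F. \<Sum>J\<in>F. pairing f (haar J) * pairing w (haar J)"
    let ?J = "dyadic (k - 1) (2 * m)"
    let ?R = "rises L n L (k - 1) (2 * m + 1)" and ?M = "rises L n i (k - 2) (4 * m + 1)"
    note sub = dyadic_children[of k m]
    have f: "f x = indicator (stopped L n i (k - 2) (4 * m + 1)) x"
      and w: "w x = tower L n i B (k - 2) (4 * m + 1) x" if "x \<in> ?J" for x
    proof -
      have x: "x \<in> dyadic k m" using that sub(3) by blast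
      show "f x = indicator (stopped L n i (k - 2) (4 * m + 1)) x"
        using Suc.prems(1)[OF x] stopped_on_children(2)[OF that, of L n i]
        by (simp add: Suc indicator_def del: stopped.simps)
      show "w x = tower L n i B (k - 2) (4 * m + 1) x"
        using Suc.prems(2)[OF x] tower_on_children(2)[OF that] unfolding Suc by simp
    qed
    have R: "?S ?R = 3/2 * B * 2 powi (k - 1) * rise_energy L n L"
    proof (rule Suc.IH)
      fix x assume that: "x \<in> dyadic (k - 1) (2 * m + 1)"
      then have x: "x \<in> dyadic k m" using sub(1) by blast
      show "f x = indicator (stopped L n L (k - 1) (2 * m + 1)) x"
        using Suc.prems(1)[OF x] stopped_on_children(1)[OF that, of L n i]
        by (simp add: Suc indicator_def del: stopped.simps)
      show "w x = tower L n L (3/2 * B) (k - 1) (2 * m + 1) x"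
        using Suc.prems(2)[OF x] tower_on_children(1)[OF that] unfolding Suc by simp
    qed
    have M: "?S ?M = B * 2 powi (k - 2) * rise_energy L n i"
      using f w sub(2) by (intro Suc.IH) blast+
    have "pairing f (haar ?J)
        = pairing (indicator (stopped L n i (k - 2) (4 * m + 1))) (haar ?J)"
      using f by (rule pairing_haar_cong)
    also have "\<dots> = (\<integral>x. indicator (stopped L n i (k - 2) (4 * m + 1)) x \<partial>lebesgue)
        / sqrt (2 powi (k - 1))"
      using stopped_subset[of L n i "k - 2" "4 * m + 1"]
      by (intro pairing_haar_right_half) (auto simp: indicator_def)
    also have "\<dots> = 2 powi (k - 2) * stopped_fraction L n i / sqrt (2 powi (k - 1))"
      using measure_stopped[of L n i "k - 2" "4 * m + 1"] by simp
    finally have pf: "pairing f (haar ?J) = \<dots>" .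
    have "pairing w (haar ?J) = pairing (tower L n i B (k - 2) (4 * m + 1)) (haar ?J)"
      using w by (rule pairing_haar_cong)
    also have "\<dots> = (\<integral>x. tower L n i B (k - 2) (4 * m + 1) x \<partial>lebesgue) / sqrt (2 powi (k - 1))"
      by (intro pairing_haar_right_half tower_outside) auto
    also have "\<dots> = B * 2 powi (k - 2) / sqrt (2 powi (k - 1))"
      using has_integral_tower[of L n i B "k - 2" "4 * m + 1"] by (simp add: has_bochner_integral_iff)
    finally have pw: "pairing w (haar ?J) = \<dots>" .
    have J: "pairing f (haar ?J) * pairing w (haar ?J) = B * 2 powi k * stopped_fraction L n i / 8"
      unfolding pf pw powi_pred by (simp add: field_simps)
    \<comment> \<open>The three parts of the set of rises are disjoint, so the sum splits.\<close>
    have "?J \<notin> ?R" using rises_subset[of ?J L n L "k - 1" "2 * m + 1"] dyadic_nonempty sub(4) by blast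
    moreover have "?J \<notin> ?M"
    proof
      assume "?J \<in> ?M"
      then have "emeasure lebesgue ?J \<le> emeasure lebesgue (dyadic (k - 2) (4 * m + 1))"
        by (intro emeasure_mono rises_subset) auto
      then show False by (simp add: emeasure_dyadic powi_pred)
    qed
    moreover have "?R \<inter> ?M = {}"
    proof (rule ccontr)
      assume "?R \<inter> ?M \<noteq> {}"
      then obtain I where I: "I \<in> ?R" "I \<in> ?M" by blast
      then have "I \<subseteq> dyadic (k - 1) (2 * m + 1) \<inter> dyadic (k - 2) (4 * m + 1)"
        using rises_subset by blast
      then have "I = {}" using sub by blast
      then show False using rises_dyadic[OF I(1)] dyadic_nonempty by metis
    qed
    ultimately have "?S (rises L (Suc n) (Suc i) k m)
        = pairing f (haar ?J) * pairing w (haar ?J) + (?S ?R + ?S ?M)"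
      by (simp add: finite_rises sum.union_disjoint)
    then show ?thesis unfolding Suc R M J by (simp add: powi_pred field_simps)
  qed
qed

section \<open>Haar multipliers on functions with finitely many relevant coefficients\<close>

lemma integrable_haar_mult:
  assumes "I \<in> dyadic_grid" "integrable lebesgue f"
  shows "integrable lebesgue (\<lambda>x. haar I x * f x)"
proof -
  obtain k m where I: "I = dyadic k m" using assms(1) by (auto simp: dyadic_grid_eq)
  have "integrable lebesgue (\<lambda>x. (indicator (right_half I) x * f x - indicator (left_half I) x * f x)
      / sqrt (measure lebesgue I))"
    using assms(2) integrable_mult_indicator[of _ lebesgue f] unfolding I dyadic_halves
    by (auto intro!: Bochner_Integration.integrable_diff integrable_divide)
  then show ?thesis unfolding haar_def by (simp add: diff_divide_distrib left_diff_distrib)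
qed

lemma integrable_haar:
  assumes "I \<in> dyadic_grid"
  shows "integrable lebesgue (haar I)"
proof -
  obtain k m where I: "I = dyadic k m" using assms(1) by (auto simp: dyadic_grid_eq)
  show ?thesis unfolding haar_def I dyadic_halves
    by (auto intro!: Bochner_Integration.integrable_diff integrable_divide simp: emeasure_dyadic)
qed

lemma square_integrable_haar_sum:
  assumes "finite F" "F \<subseteq> dyadic_grid"
  shows "square_integrable (\<lambda>x. \<Sum>I\<in>F. c I * haar I x)"
proof -
  have 1: "integrable lebesgue (\<lambda>x. \<Sum>I\<in>F. \<Sum>J\<in>F. c I * c J * (haar I x * haar J x))"
    using assms
    by (intro Bochner_Integration.integrable_sum integrable_mult_right integrable_haar_mult
        integrable_haar) auto
  have "(\<lambda>x. \<Sum>I\<in>F. c I * haar I x) \<in> borel_measurable lebesgue"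
    using assms integrable_haar
    by (intro borel_measurable_integrable Bochner_Integration.integrable_sum integrable_mult_right) auto
  then show ?thesis using 1
    by (simp add: square_integrable_def power2_eq_square sum_product mult_ac)
qed

lemma square_integrable_diff:
  assumes "square_integrable f" "square_integrable g"
  shows "integrable lebesgue (\<lambda>x. (f x - g x)\<^sup>2)"
proof (rule Bochner_Integration.integrable_bound)
  show "integrable lebesgue (\<lambda>x. 2 * (f x)\<^sup>2 + 2 * (g x)\<^sup>2)"
    using assms by (auto simp: square_integrable_def)
  show "(\<lambda>x. (f x - g x)\<^sup>2) \<in> borel_measurable lebesgue"
    using assms unfolding square_integrable_def by (intro borel_measurable_power borel_measurable_diff) auto
  have "(f x - g x)\<^sup>2 \<le> 2 * (f x)\<^sup>2 + 2 * (g x)\<^sup>2" for x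
    using zero_le_power2[of "f x + g x"] by (simp add: power2_eq_square algebra_simps)
  then show "AE x in lebesgue. norm ((f x - g x)\<^sup>2) \<le> norm (2 * (f x)\<^sup>2 + 2 * (g x)\<^sup>2)"
    by simp
qed

text \<open>The partial sums are eventually constant along the net of finite sets of intervals, so the
  finite sum is a limit, and any other limit agrees with it almost everywhere.\<close>

lemma haar_multiplier_finite:
  assumes F: "finite F" "F \<subseteq> dyadic_grid"
    and zero: "\<And>I. I \<in> dyadic_grid - F \<Longrightarrow> \<epsilon> I * pairing f (haar I) = 0"
  shows "AE x in lebesgue.
    haar_multiplier \<epsilon> f x = (\<Sum>I\<in>F. \<epsilon> I * pairing f (haar I) * haar I x)"
proof -
  define g where "g x = (\<Sum>I\<in>F. \<epsilon> I * pairing f (haar I) * haar I x)" for x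
  let ?P = "\<lambda>h. square_integrable h \<and>
     ((\<lambda>F. \<integral>x. ((\<Sum>I\<in>F. \<epsilon> I * pairing f (haar I) * haar I x) - h x)\<^sup>2 \<partial>lebesgue) \<longlongrightarrow> 0)
       (finite_subsets_at_top dyadic_grid)"
  have g: "square_integrable g"
    unfolding g_def by (rule square_integrable_haar_sum[OF F])
  have ev: "\<forall>\<^sub>F F' in finite_subsets_at_top dyadic_grid.
      (\<integral>x. ((\<Sum>I\<in>F'. \<epsilon> I * pairing f (haar I) * haar I x) - h x)\<^sup>2 \<partial>lebesgue)
      = (\<integral>x. (g x - h x)\<^sup>2 \<partial>lebesgue)" for h
    unfolding eventually_finite_subsets_at_top
  proof (intro exI[of _ F] conjI allI impI F)
    fix F' assume F': "finite F' \<and> F \<subseteq> F' \<and> F' \<subseteq> dyadic_grid"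
    have "(\<Sum>I\<in>F'. \<epsilon> I * pairing f (haar I) * haar I x) = g x" for x
      unfolding g_def using F' zero by (intro sum.mono_neutral_right) auto
    then show "(\<integral>x. ((\<Sum>I\<in>F'. \<epsilon> I * pairing f (haar I) * haar I x) - h x)\<^sup>2 \<partial>lebesgue)
      = (\<integral>x. (g x - h x)\<^sup>2 \<partial>lebesgue)" by simp
  qed
  have "?P g" using g tendsto_eventually[OF ev[of g]] by simp
  then have P: "?P (haar_multiplier \<epsilon> f)"
    unfolding haar_multiplier_def by (rule someI[of ?P])
  define h where "h = haar_multiplier \<epsilon> f"
  have "((\<lambda>_. \<integral>x. (g x - h x)\<^sup>2 \<partial>lebesgue) \<longlongrightarrow> 0) (finite_subsets_at_top dyadic_grid)"
    using P unfolding h_def[symmetric] tendsto_cong[OF ev[of h]] by simp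
  then have "(\<integral>x. (g x - h x)\<^sup>2 \<partial>lebesgue) = 0"
    by (simp add: tendsto_const_iff)
  then have "AE x in lebesgue. (g x - h x)\<^sup>2 = 0"
    using square_integrable_diff[OF g, of h] P
    by (subst (asm) integral_nonneg_eq_0_iff_AE) (auto simp: h_def)
  then show ?thesis by eventually_elim (simp add: g_def h_def)
qed

section \<open>One tower on every unit interval\<close>

definition depth :: "nat \<Rightarrow> nat" where
  "depth L = (SOME n. 1/2 \<le> stopped_mass L n L)"

lemma depth: "1/2 \<le> stopped_mass L (depth L) L"
proof -
  have "\<forall>\<^sub>F n in sequentially. 1/2 < stopped_mass L n L"
    using stopped_mass_tendsto by (rule order_tendstoD) simp
  then have "\<exists>n. 1/2 \<le> stopped_mass L n L"
    by (metis eventually_sequentially less_imp_le order_refl)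
  then show ?thesis unfolding depth_def by (rule someI_ex)
qed

text \<open>On the negative half-line \<open>L = 0\<close> and the row is constantly \<open>1\<close>. This way every unit
  interval has mass \<open>1\<close>.\<close>

definition tower_row :: "real \<Rightarrow> real" where
  "tower_row x = (let m = \<lfloor>x\<rfloor>; L = nat m in tower L (depth L) L 1 0 m x)"

definition rise_symbol :: "real set \<Rightarrow> real" where
  "rise_symbol I = indicator (\<Union>L. rises L (depth L) L 0 (int L)) I"

lemma tower_row_on:
  "x \<in> dyadic 0 m \<Longrightarrow> tower_row x = tower (nat m) (depth (nat m)) (nat m) 1 0 m x"
  by (simp add: tower_row_def mem_dyadic_iff Let_def)

lemma tower_row_measurable [measurable]: "tower_row \<in> borel_measurable lebesgue"
proof -
  have "(\<lambda>x::real. \<lfloor>x\<rfloor>) \<in> borel \<rightarrow>\<^sub>M count_space UNIV" by measurable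
  then have fl: "(\<lambda>x::real. \<lfloor>x\<rfloor>) \<in> lebesgue \<rightarrow>\<^sub>M count_space UNIV"
    by (intro measurable_completion) simp
  have "(\<lambda>x. (\<lambda>m. tower (nat m) (depth (nat m)) (nat m) 1 0 m) \<lfloor>x\<rfloor> x) \<in> borel_measurable lebesgue"
    by (rule measurable_compose_countable[OF _ fl]) (rule tower_measurable)
  then show ?thesis unfolding tower_row_def[abs_def] Let_def by simp
qed

lemma tower_row_nonneg: "0 \<le> tower_row x"
  by (simp add: tower_row_def Let_def tower_nonneg)

lemma nn_integral_tower_row:
  "0 \<le> k \<Longrightarrow> (\<integral>\<^sup>+x\<in>dyadic k m. ennreal (tower_row x) \<partial>lebesgue) = ennreal (2 powi k)"
proof (induction k arbitrary: m rule: int_ge_induct)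
  case base
  have "(\<integral>\<^sup>+x\<in>dyadic 0 m. ennreal (tower_row x) \<partial>lebesgue)
      = (\<integral>\<^sup>+x. ennreal (tower (nat m) (depth (nat m)) (nat m) 1 0 m x) \<partial>lebesgue)"
    by (intro nn_integral_cong) (auto simp: indicator_def tower_row_on tower_outside)
  then show ?case by (simp add: nn_integral_tower)
next
  case (step k)
  have "(\<integral>\<^sup>+x\<in>dyadic (k + 1) m. ennreal (tower_row x) \<partial>lebesgue)
      = (\<integral>\<^sup>+x\<in>dyadic k (2 * m). ennreal (tower_row x) \<partial>lebesgue)
        + (\<integral>\<^sup>+x\<in>dyadic k (2 * m + 1). ennreal (tower_row x) \<partial>lebesgue)"
    using dyadic_split[of "k + 1" m] dyadic_children(4)[of "k + 1" m]
    by (simp add: nn_integral_disjoint_pair Int_commute)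
  also have "\<dots> = ennreal (2 powi k + 2 powi k)" unfolding step.IH by (subst ennreal_plus) auto
  finally show ?case by (simp add: power_int_add mult.commute)
qed

lemma weight_tower_row: "weight tower_row"
  unfolding weight_def
proof (intro conjI allI impI)
  fix K :: "real set" assume "compact K"
  then obtain R where R: "\<And>x. x \<in> K \<Longrightarrow> \<bar>x\<bar> \<le> R"
    using compact_imp_bounded bounded_iff by (metis real_norm_def)
  obtain n where n: "R < 2 ^ n" using real_arch_pow[of 2 R] by auto
  have K: "K \<subseteq> dyadic (int n) (-1) \<union> dyadic (int n) 0"
    using R n unfolding dyadic_def by (fastforce simp: power_int_of_nat)
  have [measurable]: "K \<in> sets lebesgue" using \<open>compact K\<close> by (simp add: lmeasurable_compact fmeasurableD)
  have "(\<integral>\<^sup>+x. ennreal (norm (indicator K x *\<^sub>R tower_row x)) \<partial>lebesgue)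
     \<le> (\<integral>\<^sup>+x\<in>dyadic (int n) (-1) \<union> dyadic (int n) 0. ennreal (tower_row x) \<partial>lebesgue)"
    using K by (intro nn_integral_mono) (auto simp: indicator_def tower_row_nonneg)
  also have "\<dots> = (\<integral>\<^sup>+x\<in>dyadic (int n) (-1). ennreal (tower_row x) \<partial>lebesgue)
       + (\<integral>\<^sup>+x\<in>dyadic (int n) 0. ennreal (tower_row x) \<partial>lebesgue)"
    using dyadic_unique[of _ "int n" "-1" 0] by (intro nn_integral_disjoint_pair) auto
  also have "\<dots> < \<infinity>" by (simp add: nn_integral_tower_row)
  finally show "set_integrable lebesgue K tower_row"
    unfolding set_integrable_def by (intro integrableI_bounded) auto
qed (rule tower_row_nonneg)

text \<open>Intervals of length at most \<open>1\<close> are controlled inside the tower. The average over a longer one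
  is \<open>1\<close>, and the tower starts with average \<open>1\<close>, so it is at least \<open>1\<close> on the stopped set.\<close>

lemma dyadic_maximal_tower_row_le:
  assumes x: "x \<in> stopped L (depth L) L 0 (int L)"
  shows "dyadic_maximal tower_row x \<le> ennreal (tower_row x)"
  unfolding dyadic_maximal_def
proof (rule SUP_least)
  fix Q assume "Q \<in> dyadic_grid"
  then obtain k m where Q: "Q = dyadic k m" by (auto simp: dyadic_grid_eq)
  let ?W = "tower L (depth L) L 1 0 (int L)"
  have xL: "x \<in> dyadic 0 (int L)" using x stopped_subset by blast
  have eq: "tower_row y = ?W y" if "y \<in> dyadic 0 (int L)" for y
    using tower_row_on[OF that] by simp
  show "indicator Q x / emeasure lebesgue Q * (\<integral>\<^sup>+y\<in>Q. ennreal (tower_row y) \<partial>lebesgue)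
    \<le> ennreal (tower_row x)"
  proof (cases "x \<in> Q")
    case True
    have "(\<integral>\<^sup>+y\<in>Q. ennreal (tower_row y) \<partial>lebesgue) \<le> ennreal (tower_row x * 2 powi k)"
    proof (cases "k \<le> 0")
      case k: True
      have "Q \<subseteq> dyadic 0 (int L)" using dyadic_nested True xL k unfolding Q by blast
      then have "(\<integral>\<^sup>+y\<in>Q. ennreal (tower_row y) \<partial>lebesgue) = (\<integral>\<^sup>+y\<in>Q. ennreal (?W y) \<partial>lebesgue)"
        using eq by (intro nn_integral_cong) (auto simp: indicator_def)
      also have "\<dots> \<le> ennreal (?W x * 2 powi k)"
        using tower_average_le[OF x, of k m 1] True k unfolding Q by simp
      finally show ?thesis using eq xL by simp
    next
      case False
      have "1 \<le> tower_row x" using tower_ge_on_stopped[OF _ x] eq xL by simp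
      then show ?thesis using False unfolding Q
        by (subst nn_integral_tower_row) (auto intro!: ennreal_leI)
    qed
    then have "indicator Q x / emeasure lebesgue Q * (\<integral>\<^sup>+y\<in>Q. ennreal (tower_row y) \<partial>lebesgue)
        \<le> 1 / ennreal (2 powi k) * ennreal (tower_row x * 2 powi k)"
      using True unfolding Q emeasure_dyadic by (intro mult_mono) auto
    also have "\<dots> = ennreal (tower_row x)"
      using tower_row_nonneg
      by (simp add: ennreal_1[symmetric] divide_ennreal ennreal_mult[symmetric] del: ennreal_1)
    finally show ?thesis .
  qed simp
qed

lemma maximal_weight_le:
  assumes "0 < w x" "dyadic_maximal w x \<le> ennreal (w x)"
  shows "maximal_weight w x \<le> ennreal (w x)"
proof -
  have "maximal_weight w x \<le> (ennreal (w x))\<^sup>2 / ennreal (w x)"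
    unfolding maximal_weight_def using assms by (intro divide_right_mono_ennreal power_mono) auto
  also have "\<dots> = ennreal ((w x)\<^sup>2 / w x)"
    using assms(1) by (simp add: ennreal_power divide_ennreal)
  also have "\<dots> = ennreal (w x)"
    using assms(1) by (simp add: power2_eq_square)
  finally show ?thesis .
qed

section \<open>Testing the inequality on the stopped sets\<close>

lemma nn_integral_test_le:
  "(\<integral>\<^sup>+x. ennreal (\<bar>indicator (stopped L (depth L) L 0 (int L)) x\<bar>\<^sup>2) * maximal_weight tower_row x
     \<partial>lebesgue) \<le> 1"
proof -
  let ?E = "stopped L (depth L) L 0 (int L)"
  have "(\<integral>\<^sup>+x. ennreal (\<bar>indicator ?E x\<bar>\<^sup>2) * maximal_weight tower_row x \<partial>lebesgue)
    \<le> (\<integral>\<^sup>+x\<in>dyadic 0 (int L). ennreal (tower_row x) \<partial>lebesgue)"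
  proof (rule nn_integral_mono)
    fix x
    show "ennreal (\<bar>indicator ?E x\<bar>\<^sup>2) * maximal_weight tower_row x
      \<le> ennreal (tower_row x) * indicator (dyadic 0 (int L)) x"
    proof (cases "x \<in> ?E")
      case True
      then have xL: "x \<in> dyadic 0 (int L)" using stopped_subset by blast
      have "1 \<le> tower_row x" using tower_ge_on_stopped[OF _ True, of 1] tower_row_on[OF xL] by simp
      then have "maximal_weight tower_row x \<le> ennreal (tower_row x)"
        using dyadic_maximal_tower_row_le[OF True] by (intro maximal_weight_le) auto
      then show ?thesis using True xL by simp
    qed simp
  qed
  then show ?thesis by (simp add: nn_integral_tower_row)
qed

text \<open>Self-adjointness turns \<open>\<integral> T(1\<^sub>E) w\<close> into the sum of products of pairings, which is at least
  \<open>L/4\<close>. Since \<open>w\<close> has mass \<open>1\<close> on the unit interval, the second moment of \<open>T(1\<^sub>E)\<close> is at least the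
  square of this mean; this is used in the form \<open>t\<^sup>2 \<ge> 2 c t - c\<^sup>2\<close> with \<open>c = L/4\<close>.\<close>

lemma nn_integral_multiplier_ge:
  fixes L :: nat
  defines "f \<equiv> indicator (stopped L (depth L) L 0 (int L)) :: real \<Rightarrow> real"
  shows "ennreal ((real L)\<^sup>2 / 16)
    \<le> (\<integral>\<^sup>+x. ennreal (\<bar>haar_multiplier rise_symbol f x\<bar>\<^sup>2) * ennreal (tower_row x) \<partial>lebesgue)"
proof -
  let ?F = "rises L (depth L) L 0 (int L)"
  let ?W = "tower L (depth L) L 1 0 (int L)"
  let ?c = "real L / 4"
  define g where "g x = (\<Sum>I\<in>?F. pairing f (haar I) * haar I x)" for x
  have F: "finite ?F" "?F \<subseteq> dyadic_grid"
    using finite_rises rises_dyadic[of _ L "depth L" L 0 "int L"] dyadic_in_grid by (blast, fastforce)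
  have "AE x in lebesgue. haar_multiplier rise_symbol f x
      = (\<Sum>I\<in>?F. rise_symbol I * pairing f (haar I) * haar I x)"
  proof (rule haar_multiplier_finite[OF F])
    fix I assume I: "I \<in> dyadic_grid - ?F"
    show "rise_symbol I * pairing f (haar I) = 0"
    proof (cases "rise_symbol I = 0")
      case False
      then obtain L' where L': "I \<in> rises L' (depth L') L' 0 (int L')"
        unfolding rise_symbol_def by (auto simp: indicator_eq_0_iff)
      with I have "L' \<noteq> L" by auto
      obtain k m where km: "I = dyadic k m" using rises_dyadic[OF L'] by blast
      \<comment> \<open>An interval selected inside another unit interval does not meet the support of \<open>f\<close>.\<close>
      have "f x = 0" if "x \<in> I" for x
      proof -
        have "x \<in> dyadic 0 (int L')" using rises_subset[OF L'] that by blast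
        then have "x \<notin> dyadic 0 (int L)" using dyadic_unique \<open>L' \<noteq> L\<close> by (metis of_nat_eq_iff)
        then show ?thesis using stopped_subset[of L "depth L" L 0 "int L"] unfolding f_def
          by (auto simp: indicator_def)
      qed
      then have "pairing f (haar I) = pairing (\<lambda>_. 0) (haar I)"
        unfolding km by (intro pairing_haar_cong) auto
      then show ?thesis by (simp add: pairing_def)
    qed simp
  qed
  moreover have "(\<Sum>I\<in>?F. rise_symbol I * pairing f (haar I) * haar I x) = g x" for x
    unfolding g_def by (intro sum.cong) (auto simp: rise_symbol_def indicator_def)
  ultimately have Tf: "AE x in lebesgue. haar_multiplier rise_symbol f x = g x" by simp
  have W: "integrable lebesgue ?W" "integral\<^sup>L lebesgue ?W = 1"
    using has_integral_tower[of L "depth L" L 1 0 "int L"] by (auto simp: has_bochner_integral_iff)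
  have gW: "integrable lebesgue (\<lambda>x. g x * ?W x)"
  proof -
    have "integrable lebesgue (\<lambda>x. \<Sum>I\<in>?F. pairing f (haar I) * (haar I x * ?W x))"
      using F(2) W by (intro Bochner_Integration.integrable_sum integrable_mult_right integrable_haar_mult) auto
    then show ?thesis by (simp only: g_def sum_distrib_right mult.assoc)
  qed
  have ggW: "integrable lebesgue (\<lambda>x. (g x)\<^sup>2 * ?W x)"
  proof -
    have "integrable lebesgue (\<lambda>x. \<Sum>I\<in>?F. pairing f (haar I) * (haar I x * (g x * ?W x)))"
      using F(2) gW by (intro Bochner_Integration.integrable_sum integrable_mult_right integrable_haar_mult) auto
    moreover have "(\<Sum>I\<in>?F. pairing f (haar I) * (haar I x * (g x * ?W x))) = (g x)\<^sup>2 * ?W x" for x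
    proof -
      have "(\<Sum>I\<in>?F. pairing f (haar I) * (haar I x * (g x * ?W x))) = g x * (g x * ?W x)"
        by (subst (1) g_def) (simp only: sum_distrib_right mult.assoc)
      then show ?thesis by (simp add: power2_eq_square mult.assoc)
    qed
    ultimately show ?thesis by simp
  qed
  have "(\<integral>x. g x * ?W x \<partial>lebesgue) = (\<integral>x. (\<Sum>I\<in>?F. pairing f (haar I) * (haar I x * ?W x)) \<partial>lebesgue)"
    by (simp only: g_def sum_distrib_right mult.assoc)
  also have "\<dots> = (\<Sum>I\<in>?F. pairing f (haar I) * (\<integral>x. haar I x * ?W x \<partial>lebesgue))"
    using F(2) W by (subst Bochner_Integration.integral_sum) (auto intro!: integrable_haar_mult)
  also have "\<dots> = (\<Sum>I\<in>?F. pairing f (haar I) * pairing ?W (haar I))"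
    by (simp add: pairing_def mult.commute)
  also have "\<dots> = rise_energy L (depth L) L"
    using sum_rises[of 0 "int L" f L "depth L" L ?W 1] by (simp add: f_def)
  finally have V: "(\<integral>x. g x * ?W x \<partial>lebesgue) = rise_energy L (depth L) L" .
  have Vge: "?c \<le> rise_energy L (depth L) L"
  proof -
    have "real L / 2 * (1/2) \<le> real L / 2 * stopped_mass L (depth L) L"
      using depth by (intro mult_left_mono) auto
    then show ?thesis using rise_energy_ge[of L L "depth L"] by simp
  qed
  have "(real L)\<^sup>2 / 16 = 2 * ?c * ?c - ?c\<^sup>2" by (simp add: power2_eq_square)
  also have "\<dots> \<le> 2 * ?c * (\<integral>x. g x * ?W x \<partial>lebesgue) - ?c\<^sup>2 * (\<integral>x. ?W x \<partial>lebesgue)"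
    unfolding V W(2) using mult_left_mono[OF Vge, of "2 * ?c"] by simp
  also have "\<dots> = (\<integral>x. 2 * ?c * (g x * ?W x) - ?c\<^sup>2 * ?W x \<partial>lebesgue)"
    using gW W(1) by (subst Bochner_Integration.integral_diff) auto
  also have "\<dots> \<le> (\<integral>x. (g x)\<^sup>2 * ?W x \<partial>lebesgue)"
  proof (intro integral_mono ggW)
    show "integrable lebesgue (\<lambda>x. 2 * ?c * (g x * ?W x) - ?c\<^sup>2 * ?W x)"
      using gW W(1) by auto
    fix x
    have "0 \<le> (g x - ?c)\<^sup>2 * ?W x" by (simp add: tower_nonneg)
    then show "2 * ?c * (g x * ?W x) - ?c\<^sup>2 * ?W x \<le> (g x)\<^sup>2 * ?W x"
      by (simp add: power2_eq_square algebra_simps)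
  qed
  finally have "ennreal ((real L)\<^sup>2 / 16) \<le> ennreal (\<integral>x. (g x)\<^sup>2 * ?W x \<partial>lebesgue)"
    by (rule ennreal_leI)
  also have "\<dots> = (\<integral>\<^sup>+x. ennreal ((g x)\<^sup>2 * ?W x) \<partial>lebesgue)"
    using ggW by (subst nn_integral_eq_integral) (auto simp: tower_nonneg)
  also have "\<dots> \<le> (\<integral>\<^sup>+x. ennreal (\<bar>haar_multiplier rise_symbol f x\<bar>\<^sup>2) * ennreal (tower_row x) \<partial>lebesgue)"
  proof (rule nn_integral_mono_AE, use Tf in eventually_elim)
    fix x assume eq: "haar_multiplier rise_symbol f x = g x"
    have "?W x \<le> tower_row x"
      using tower_row_on[of x "int L"] tower_outside tower_row_nonneg
      by (cases "x \<in> dyadic 0 (int L)") auto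
    then show "ennreal ((g x)\<^sup>2 * ?W x)
      \<le> ennreal (\<bar>haar_multiplier rise_symbol f x\<bar>\<^sup>2) * ennreal (tower_row x)"
      unfolding eq using tower_row_nonneg
      by (simp add: ennreal_mult[symmetric] ennreal_leI mult_left_mono)
  qed
  finally show ?thesis .
qed

theorem theorem1p4:
  "\<exists>(w :: real \<Rightarrow> real) (\<epsilon> :: real set \<Rightarrow> real).
     weight w \<and> bounded (\<epsilon> ` dyadic_grid) \<and>
     \<not> (\<exists>C::real. 0 \<le> C \<and>
          (\<forall>f. square_integrable f \<longrightarrow>
            (\<integral>\<^sup>+x. ennreal (\<bar>haar_multiplier \<epsilon> f x\<bar>\<^sup>2) * ennreal (w x) \<partial>lebesgue)
            \<le> ennreal C * (\<integral>\<^sup>+x. ennreal (\<bar>f x\<bar>\<^sup>2) * maximal_weight w x \<partial>lebesgue)))"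
proof (intro exI[of _ tower_row] exI[of _ rise_symbol] conjI notI weight_tower_row)
  show "bounded (rise_symbol ` dyadic_grid)"
    by (intro boundedI[of _ 1]) (auto simp: rise_symbol_def indicator_def)
next
  assume "\<exists>C::real. 0 \<le> C \<and>
          (\<forall>f. square_integrable f \<longrightarrow>
            (\<integral>\<^sup>+x. ennreal (\<bar>haar_multiplier rise_symbol f x\<bar>\<^sup>2) * ennreal (tower_row x) \<partial>lebesgue)
            \<le> ennreal C * (\<integral>\<^sup>+x. ennreal (\<bar>f x\<bar>\<^sup>2) * maximal_weight tower_row x \<partial>lebesgue))"
  then obtain C where C: "0 \<le> C" and bound: "\<And>f. square_integrable f \<Longrightarrow>
      (\<integral>\<^sup>+x. ennreal (\<bar>haar_multiplier rise_symbol f x\<bar>\<^sup>2) * ennreal (tower_row x) \<partial>lebesgue)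
      \<le> ennreal C * (\<integral>\<^sup>+x. ennreal (\<bar>f x\<bar>\<^sup>2) * maximal_weight tower_row x \<partial>lebesgue)"
    by blast
  obtain L :: nat where L: "16 * C + 1 < real L" using reals_Archimedean2 by blast
  let ?f = "indicator (stopped L (depth L) L 0 (int L)) :: real \<Rightarrow> real"
  have "square_integrable ?f"
    using measure_stopped[of L "depth L" L 0 "int L"]
    by (auto simp: square_integrable_def fmeasurable_def power2_eq_square indicator_inter_arith[symmetric])
  note bound[OF this]
  also have "ennreal C * (\<integral>\<^sup>+x. ennreal (\<bar>?f x\<bar>\<^sup>2) * maximal_weight tower_row x \<partial>lebesgue)
      \<le> ennreal C * 1"
    by (rule mult_left_mono[OF nn_integral_test_le]) simp
  finally have "ennreal ((real L)\<^sup>2 / 16) \<le> ennreal C * 1"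
    by (rule order_trans[OF nn_integral_multiplier_ge])
  then have "(real L)\<^sup>2 \<le> 16 * C" using C by (simp add: ennreal_le_iff)
  moreover have "real L * 1 \<le> real L * real L" using L C by (intro mult_left_mono) auto
  ultimately show False using L by (simp add: power2_eq_square)
qed

end
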